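(* Let $\tau,\beta>0$ and let $A\in M_N(\mathbb{R})$ be a matrix with positive entries. Let $m=\min_{j\ne k}A_{jk}>0$ and suppose $m>\frac1\tau$. Then the system $$\frac{d}{dt}z_j=\sum_{l=1}^N A_{jl}(z_l-z_j)+\frac1\tau\Bigl(1-\frac{|z_j|^2}{\beta^2}\Bigr)z_j,\qquad z_j\in\mathbb{C},\ j\in\{1,\dots,N\},$$ converges to a fully synchronized state, in the sense that for every solution there is a constant $C\geq 0$ such that for all $t\ge 0$ $$\max_{j,k\in\{1,\dots,N\}}|z_j(t)-z_k(t)|\le C\,e^{-(m-\frac1\tau)t}.$$
   Context: A solution is at a synchronized state at time $t$ if there is $z^\infty\in\mathbb{C}$ with $z_j(t)=z^\infty$ for all $j$. The matrix $A$ is not assumed symmetric or circulant, and the initial data are arbitrary. *)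

theory Defs
  imports "HOL-Analysis.Analysis"
begin

definition offdiag_min :: "real ^ 'n ^ 'n \<Rightarrow> real" where
  "offdiag_min A = Min {A $ j $ k | j k. j \<noteq> k}"

definition coupled_rhs ::
    "real \<Rightarrow> real \<Rightarrow> real ^ 'n ^ 'n \<Rightarrow> complex ^ 'n \<Rightarrow> 'n \<Rightarrow> complex" where
  "coupled_rhs \<tau> \<beta> A w j =
     (\<Sum>l\<in>UNIV. A $ j $ l *\<^sub>R (w $ l - w $ j))
       + ((1 / \<tau>) * (1 - (cmod (w $ j))\<^sup>2 / \<beta>\<^sup>2)) *\<^sub>R (w $ j)"

(* Solutions are defined for all times t \<ge> 0, with a one-sided derivative at t = 0;
   the values of z at negative times play no role. *)
definition coupled_solution ::
    "real \<Rightarrow> real \<Rightarrow> real ^ 'n ^ 'n \<Rightarrow> (real \<Rightarrow> complex ^ 'n) \<Rightarrow> bool" where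
  "coupled_solution \<tau> \<beta> A z \<longleftrightarrow>
     (\<forall>t\<ge>0. \<forall>j. ((\<lambda>s. z s $ j) has_vector_derivative coupled_rhs \<tau> \<beta> A (z t) j)
                  (at t within {0..}))"

end

theory Submission
  imports Defs
begin

text \<open>
  The diameter of the configuration, rather than any individual state, is the right quantity to
  follow. Let \<open>j\<close>, \<open>k\<close> realise the maximal distance at some time and put \<open>d = z\<^sub>j - z\<^sub>k\<close>. All other
  points lie in the ball of radius \<open>\<bar>d\<bar>\<close> around \<open>z\<^sub>j\<close> and in the one around \<open>z\<^sub>k\<close>, so in direction
  \<open>d\<close> each of them pulls \<open>z\<^sub>j\<close> backwards and \<open>z\<^sub>k\<close> forwards. Every coupling term therefore has a
  favourable sign, and each weight may be replaced by its lower bound \<open>m\<close>. This makes the rows of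
  \<open>j\<close> and \<open>k\<close> identical, whatever \<open>A\<close> was, so the positions of the other points cancel and the
  \<open>N\<close> terms add up to exactly \<open>- N * m * \<bar>d\<bar>\<^sup>2\<close> (\<open>consensus_contracts_diameter\<close>). The cubic part of the reaction term is
  monotone (\<open>cubic_monotone\<close>) and only helps, while its linear part costs \<open>\<bar>d\<bar>\<^sup>2 / \<tau>\<close>.

  Hence a maximal distance, squared and multiplied by \<open>exp (2 * (m - 1 / \<tau>) * t)\<close>, has negative
  derivative as long as it is nonzero: the rate \<open>N * m\<close> is strictly better than the \<open>m\<close> that is
  claimed. The maximum over all pairs need not be differentiable, but one never has to
  differentiate it: finitely many functions cannot cross a level upwards if each of them is
  decreasing whenever it is the first to touch that level (\<open>finite_family_stays_below\<close>).
\<close>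

text \<open>
  This replaces a differential inequality for the maximum of the family. At the first time some
  member reaches the level, every member is still at most \<open>K\<close>, so the hypothesis applies; but a
  function with negative derivative was above \<open>K\<close> just before.
\<close>

lemma finite_family_stays_below:
  fixes f f' :: "'i \<Rightarrow> real \<Rightarrow> real" and K :: real
  assumes "finite I"
    and deriv: "\<And>i t. i \<in> I \<Longrightarrow> t \<ge> 0 \<Longrightarrow> (f i has_real_derivative f' i t) (at t within {0..})"
    and init: "\<And>i. i \<in> I \<Longrightarrow> f i 0 < K"
    and decr: "\<And>i t. i \<in> I \<Longrightarrow> t > 0 \<Longrightarrow> f i t = K \<Longrightarrow> (\<And>q. q \<in> I \<Longrightarrow> f q t \<le> K) \<Longrightarrow> f' i t < 0"
    and "i \<in> I" "t \<ge> 0"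
  shows "f i t < K"
proof (rule ccontr)
  assume "\<not> f i t < K"
  have cont: "continuous_on {0..u} (f q)" if "q \<in> I" for q u
    using DERIV_continuous_on[of "{0..}" "f q" "f' q"] deriv[OF that]
    by (auto intro: continuous_on_subset)
  define S where "S = (\<Union>q\<in>I. {s \<in> {0..t}. K \<le> f q s})"
  have "compact {s \<in> {0..t}. K \<le> f q s}" if "q \<in> I" for q
  proof -
    have "closed {s \<in> {0..t}. K \<le> f q s}"
      using continuous_closed_preimage[OF cont[OF that, of t], of "{K..}"]
      by (simp add: vimage_def Int_def)
    moreover have "bounded {s \<in> {0..t}. K \<le> f q s}"
      by (rule bounded_subset[of "{0..t}"]) auto
    ultimately show ?thesis
      by (simp add: compact_eq_bounded_closed)
  qed
  then have "compact S"
    unfolding S_def using \<open>finite I\<close> by (intro compact_UN) auto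
  moreover have "S \<noteq> {}"
    using \<open>i \<in> I\<close> \<open>t \<ge> 0\<close> \<open>\<not> f i t < K\<close> unfolding S_def by fastforce
  ultimately obtain u where "u \<in> S" and u_first: "\<And>s. s \<in> S \<Longrightarrow> u \<le> s"
    using compact_attains_inf[of S] by auto
  then obtain p where p: "p \<in> I" "0 \<le> u" "u \<le> t" "K \<le> f p u"
    unfolding S_def by auto
  have "u > 0"
    using init[OF p(1)] p by (cases "u = 0") auto
  have before: "f q s < K" if "q \<in> I" "0 \<le> s" "s < u" for q s
    using u_first[of s] that p unfolding S_def by force
  have at_u: "f q u \<le> K" if "q \<in> I" for q
  proof (rule continuous_le_on_closure[of "{0..<u}" "f q" u K])
    show "continuous_on (closure {0..<u}) (f q)"
      using cont[OF that] \<open>u > 0\<close> by simp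
  qed (use \<open>u > 0\<close> before[OF that] in \<open>auto intro: less_imp_le\<close>)
  then have "f' p u < 0"
    using decr[OF p(1) \<open>u > 0\<close>] p by (simp add: antisym)
  then obtain e where e: "e > 0" "\<And>h. h > 0 \<Longrightarrow> u - h \<in> {0..} \<Longrightarrow> h < e \<Longrightarrow> f p u < f p (u - h)"
    using has_real_derivative_neg_dec_left[OF deriv[OF p(1,2)]] by blast
  define h where "h = min (e / 2) u"
  have "h > 0" "h < e" "h \<le> u"
    using \<open>e > 0\<close> \<open>u > 0\<close> by (auto simp: h_def)
  then have "f p u < f p (u - h)" "f p (u - h) < K"
    using e(2) before[OF p(1)] by auto
  then show False
    using p(4) by simp
qed

text \<open>
  The map \<open>x \<mapsto> \<bar>x\<bar>\<^sup>2 x\<close> is the gradient of the convex function \<open>\<bar>x\<bar>\<^sup>4 / 4\<close>. Concretely, bounding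
  \<open>a \<bullet> b\<close> by the mean of the squared norms leaves half the square of \<open>\<bar>a\<bar>\<^sup>2 - \<bar>b\<bar>\<^sup>2\<close>.
\<close>

lemma cubic_monotone:
  fixes a b :: "'a::real_inner"
  shows "0 \<le> ((norm a)\<^sup>2 *\<^sub>R a - (norm b)\<^sup>2 *\<^sub>R b) \<bullet> (a - b)"
proof -
  let ?x = "a \<bullet> a" and ?y = "b \<bullet> b"
  have "2 * (a \<bullet> b) \<le> ?x + ?y"
    using inner_ge_zero[of "a - b"] by (simp add: inner_diff inner_commute)
  then have "(?x + ?y) * (2 * (a \<bullet> b)) \<le> (?x + ?y) * (?x + ?y)"
    by (intro mult_left_mono) auto
  moreover have "0 \<le> (?x - ?y)\<^sup>2"
    by simp
  ultimately show ?thesis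
    unfolding power2_norm_eq_inner
    by (simp add: inner_diff inner_commute power2_eq_square algebra_simps)
qed

text \<open>
  The sign conditions on the individual coupling terms are Cauchy-Schwarz: since \<open>w\<^sub>l\<close> is within
  \<open>\<bar>d\<bar>\<close> of \<open>w\<^sub>k\<close>, its component along \<open>d\<close> cannot exceed that of \<open>w\<^sub>j\<close>, and likewise with the roles
  of \<open>j\<close> and \<open>k\<close> exchanged. Once all weights are \<open>m\<close>, the contribution of \<open>l\<close> no longer depends on
  \<open>w\<^sub>l\<close>. A diagonal weight multiplies zero and can be replaced by \<open>m\<close> as well.
\<close>

lemma consensus_contracts_diameter:
  fixes w :: "'n::finite \<Rightarrow> 'a::real_inner" and A :: "'n \<Rightarrow> 'n \<Rightarrow> real"
  assumes diam_j: "\<And>l. norm (w l - w j) \<le> norm (w j - w k)"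
    and diam_k: "\<And>l. norm (w l - w k) \<le> norm (w j - w k)"
    and weights: "\<And>i l. i \<noteq> l \<Longrightarrow> m \<le> A i l"
  shows "((\<Sum>l\<in>UNIV. A j l *\<^sub>R (w l - w j)) - (\<Sum>l\<in>UNIV. A k l *\<^sub>R (w l - w k))) \<bullet> (w j - w k)
           \<le> - (real CARD('n) * m * (norm (w j - w k))\<^sup>2)"
proof -
  define d where "d = w j - w k"
  have "A j l * ((w l - w j) \<bullet> d) - A k l * ((w l - w k) \<bullet> d) \<le> - (m * (norm d)\<^sup>2)" for l
  proof -
    have "(w l - w k) \<bullet> d \<le> norm d * norm d"
      using norm_cauchy_schwarz[of "w l - w k" d] mult_right_mono[OF diam_k[of l], of "norm d"]
      by (simp add: d_def)
    then have "(w l - w j) \<bullet> d \<le> 0"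
      by (simp add: d_def inner_diff inner_commute power2_norm_eq_inner flip: power2_eq_square)
    then have j: "A j l * ((w l - w j) \<bullet> d) \<le> m * ((w l - w j) \<bullet> d)"
      using weights[of j l] by (cases "l = j") (auto intro: mult_right_mono_neg)
    have "(w j - w l) \<bullet> d \<le> norm d * norm d"
      using norm_cauchy_schwarz[of "w j - w l" d] mult_right_mono[OF diam_j[of l], of "norm d"]
      by (simp add: d_def norm_minus_commute)
    then have "(w l - w k) \<bullet> d \<ge> 0"
      by (simp add: d_def inner_diff inner_commute power2_norm_eq_inner flip: power2_eq_square)
    then have k: "m * ((w l - w k) \<bullet> d) \<le> A k l * ((w l - w k) \<bullet> d)"
      using weights[of k l] by (cases "l = k") (auto intro: mult_right_mono)
    have "m * ((w l - w j) \<bullet> d) - m * ((w l - w k) \<bullet> d) = - (m * (norm d)\<^sup>2)"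
      by (simp add: d_def inner_diff power2_norm_eq_inner algebra_simps)
    with j k show ?thesis
      by linarith
  qed
  then have "(\<Sum>l\<in>UNIV. A j l * ((w l - w j) \<bullet> d) - A k l * ((w l - w k) \<bullet> d))
               \<le> (\<Sum>l\<in>(UNIV :: 'n set). - (m * (norm d)\<^sup>2))"
    by (rule sum_mono)
  then show ?thesis
    by (simp add: d_def[symmetric] inner_diff_left inner_sum_left sum_subtractf mult.assoc)
qed

text \<open>
  The linear half of the reaction term is the only part of the right-hand side that can drive two
  most distant states apart.
\<close>

lemma coupled_rhs_contracts_diameter:
  fixes w :: "complex ^ 'n" and A :: "real ^ 'n ^ 'n"
  assumes "\<tau> > 0"
    and diam: "\<And>a b. cmod (w $ a - w $ b) \<le> cmod (w $ j - w $ k)"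
    and weights: "\<And>i l. i \<noteq> l \<Longrightarrow> m \<le> A $ i $ l"
  shows "(coupled_rhs \<tau> \<beta> A w j - coupled_rhs \<tau> \<beta> A w k) \<bullet> (w $ j - w $ k)
           \<le> (1 / \<tau> - real CARD('n) * m) * (cmod (w $ j - w $ k))\<^sup>2"
proof -
  define d where "d = w $ j - w $ k"
  define P where "P = (\<Sum>l\<in>UNIV. A $ j $ l *\<^sub>R (w $ l - w $ j))
                        - (\<Sum>l\<in>UNIV. A $ k $ l *\<^sub>R (w $ l - w $ k))"
  define Q where "Q = (cmod (w $ j))\<^sup>2 *\<^sub>R w $ j - (cmod (w $ k))\<^sup>2 *\<^sub>R w $ k"
  have "coupled_rhs \<tau> \<beta> A w j - coupled_rhs \<tau> \<beta> A w k
          = P + (1 / \<tau>) *\<^sub>R d - (1 / (\<tau> * \<beta>\<^sup>2)) *\<^sub>R Q"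
    unfolding coupled_rhs_def P_def Q_def d_def
    by (simp add: algebra_simps diff_divide_distrib)
  then have "(coupled_rhs \<tau> \<beta> A w j - coupled_rhs \<tau> \<beta> A w k) \<bullet> d
               = P \<bullet> d + (1 / \<tau>) * (cmod d)\<^sup>2 - (1 / (\<tau> * \<beta>\<^sup>2)) * (Q \<bullet> d)"
    by (simp add: inner_diff_left inner_add_left power2_norm_eq_inner)
  moreover have "P \<bullet> d \<le> - (real CARD('n) * m * (cmod d)\<^sup>2)"
    using consensus_contracts_diameter[of "\<lambda>l. w $ l" j k m "\<lambda>i l. A $ i $ l"] diam weights
    by (simp add: P_def d_def)
  moreover have "0 \<le> (1 / (\<tau> * \<beta>\<^sup>2)) * (Q \<bullet> d)"
    using cubic_monotone[of "w $ j" "w $ k"] \<open>\<tau> > 0\<close> by (simp add: Q_def d_def)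
  ultimately show ?thesis
    by (simp add: d_def[symmetric] algebra_simps)
qed

lemma offdiag_min_le:
  fixes A :: "real ^ 'n ^ 'n"
  assumes "i \<noteq> l"
  shows "offdiag_min A \<le> A $ i $ l"
proof -
  have "{A $ j $ k | j k. j \<noteq> k} \<subseteq> (\<lambda>(j, k). A $ j $ k) ` UNIV"
    by auto
  then have "finite {A $ j $ k | j k. j \<noteq> k}"
    by (rule finite_subset) simp
  then show ?thesis
    unfolding offdiag_min_def using assms by (intro Min_le) auto
qed

lemma has_real_derivative_exp_weighted_norm_square:
  fixes w :: "real \<Rightarrow> 'a::real_inner"
  assumes "(w has_vector_derivative w') (at t within S)"
  shows "((\<lambda>s. (norm (w s) * exp (c * s))\<^sup>2) has_real_derivative
            2 * (exp (c * t))\<^sup>2 * (w' \<bullet> w t + c * (norm (w t))\<^sup>2)) (at t within S)"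
proof -
  have "((\<lambda>s. w s \<bullet> w s) has_real_derivative 2 * (w' \<bullet> w t)) (at t within S)"
    using bounded_bilinear.has_vector_derivative[OF bounded_bilinear_inner assms assms]
    by (simp add: has_real_derivative_iff_has_vector_derivative inner_commute)
  moreover have "((\<lambda>s. (exp (c * s))\<^sup>2) has_real_derivative 2 * c * (exp (c * t))\<^sup>2)
                   (at t within S)"
    by (auto intro!: derivative_eq_intros simp: power2_eq_square)
  ultimately have "((\<lambda>s. (w s \<bullet> w s) * (exp (c * s))\<^sup>2) has_real_derivative
      2 * (w' \<bullet> w t) * (exp (c * t))\<^sup>2 + 2 * c * (exp (c * t))\<^sup>2 * (w t \<bullet> w t)) (at t within S)"
    by (rule DERIV_mult)
  then show ?thesis
    by (simp add: power_mult_distrib power2_norm_eq_inner algebra_simps)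
qed

theorem theorem4:
  fixes \<tau> \<beta> m :: real and A :: "real ^ 'n ^ 'n"
  assumes "\<tau> > 0" and "\<beta> > 0"
    and "CARD('n) \<ge> 2"
    and "\<forall>j k. A $ j $ k > 0"
    and "m = offdiag_min A"
    and "m > 1 / \<tau>"
  shows "\<forall>z. coupled_solution \<tau> \<beta> A z \<longrightarrow>
           (\<exists>C\<ge>0. \<forall>t\<ge>0.
              (MAX (j, k)\<in>UNIV. cmod (z t $ j - z t $ k)) \<le> C * exp (- (m - 1 / \<tau>) * t))"
proof (intro allI impI)
  fix z :: "real \<Rightarrow> complex ^ 'n"
  assume sol: "coupled_solution \<tau> \<beta> A z"
  define c where "c = m - 1 / \<tau>"
  define d where "d = (\<lambda>(j, k) t. z t $ j - z t $ k)"
  define d' where "d' = (\<lambda>(j, k) t. coupled_rhs \<tau> \<beta> A (z t) j - coupled_rhs \<tau> \<beta> A (z t) k)"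
  define f where "f = (\<lambda>p t. (cmod (d p t) * exp (c * t))\<^sup>2)"
  define f' where "f' = (\<lambda>p t. 2 * (exp (c * t))\<^sup>2 * (d' p t \<bullet> d p t + c * (cmod (d p t))\<^sup>2))"
  \<comment> \<open>The summand 1 puts the level strictly above all initial values, and keeps it positive even for
    a solution that starts synchronized.\<close>
  define K where "K = 1 + (\<Sum>p\<in>UNIV. f p 0)"
  have "m > 0"
    using \<open>\<tau> > 0\<close> \<open>m > 1 / \<tau>\<close> by (meson less_trans zero_less_divide_1_iff)
  have f_nonneg: "f p t \<ge> 0" for p t
    by (simp add: f_def)
  have "K > 0"
    unfolding K_def by (intro add_pos_nonneg sum_nonneg f_nonneg) simp
  have bound: "f p t < K" if "t \<ge> 0" for p t
  proof (rule finite_family_stays_below[where I = UNIV and f = f and f' = f' and K = K and i = p and t = t])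
    show "(f p has_real_derivative f' p s) (at s within {0..})" if "s \<ge> 0" for p s
    proof -
      obtain j k where p: "p = (j, k)"
        by force
      have "(d p has_vector_derivative d' p s) (at s within {0..})"
        using sol that unfolding coupled_solution_def p d_def d'_def
        by (auto intro!: has_vector_derivative_diff)
      then show ?thesis
        unfolding f_def f'_def by (rule has_real_derivative_exp_weighted_norm_square)
    qed
    show "f p 0 < K" for p
      using member_le_sum[of p UNIV "\<lambda>p. f p 0"] f_nonneg by (simp add: K_def)
    show "f' p s < 0" if "f p s = K" and le: "\<And>q. q \<in> UNIV \<Longrightarrow> f q s \<le> K" for p s
    proof -
      obtain j k where p: "p = (j, k)"
        by force
      have "cmod (d q s) \<le> cmod (d p s)" for q
        using le[of q] unfolding \<open>f p s = K\<close>[symmetric] f_def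
        by (simp add: power_mono_iff)
      from this[of "(_, _)"]
      have "d' p s \<bullet> d p s \<le> (1 / \<tau> - real CARD('n) * m) * (cmod (d p s))\<^sup>2"
        using coupled_rhs_contracts_diameter[OF \<open>\<tau> > 0\<close>, of "z s" j k m A \<beta>]
          offdiag_min_le[of _ _ A] \<open>m = offdiag_min A\<close>
        by (simp add: p d_def d'_def)
      \<comment> \<open>The surplus \<open>(N - 1) * m\<close> in the rate is what makes the derivative strictly negative.\<close>
      then have "d' p s \<bullet> d p s + c * (cmod (d p s))\<^sup>2 \<le> - ((real CARD('n) - 1) * m * (cmod (d p s))\<^sup>2)"
        by (simp add: c_def algebra_simps)
      moreover have "(real CARD('n) - 1) * m * (cmod (d p s))\<^sup>2 > 0"
        using \<open>f p s = K\<close> \<open>K > 0\<close> \<open>m > 0\<close> \<open>CARD('n) \<ge> 2\<close> by (auto simp: f_def)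
      ultimately have "d' p s \<bullet> d p s + c * (cmod (d p s))\<^sup>2 < 0"
        by linarith
      then show ?thesis
        unfolding f'_def by (intro mult_pos_neg) auto
    qed
  qed (use that in auto)
  have "(MAX (j, k)\<in>UNIV. cmod (z t $ j - z t $ k)) \<le> sqrt K * exp (- (m - 1 / \<tau>) * t)"
    if "t \<ge> 0" for t
  proof (rule Max.boundedI)
    fix x assume "x \<in> (\<lambda>(j, k). cmod (z t $ j - z t $ k)) ` UNIV"
    then obtain p where x: "x = cmod (d p t)"
      by (auto simp: d_def)
    have "x * exp (c * t) \<le> sqrt K"
      using bound[OF that, of p] by (auto simp: x f_def intro!: real_le_rsqrt)
    then show "x \<le> sqrt K * exp (- (m - 1 / \<tau>) * t)"
      unfolding c_def[symmetric] by (simp add: exp_minus field_simps)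
  qed auto
  then show "\<exists>C\<ge>0. \<forall>t\<ge>0.
      (MAX (j, k)\<in>UNIV. cmod (z t $ j - z t $ k)) \<le> C * exp (- (m - 1 / \<tau>) * t)"
    using \<open>K > 0\<close> by (intro exI[of _ "sqrt K"]) auto
qed

end
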